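(* Let $R$ be a finite commutative von Neumann regular ring. The graph $\Gamma'_{Reg}(R)$ is a nontrivial tree if and only if $R\cong\mathbb{F}_2\times\mathbb{F}_2$ or $R\cong\mathbb{F}_2\times\mathbb{F}_3$.
   Context: All rings have an identity. A ring $R$ is von Neumann regular if for every $x\in R$ there is $y\in R$ with $xyx=x$. For such $R$, $\Gamma'_{Reg}(R)$ is the simple graph with vertex set $R\setminus\{0_R\}$ in which two distinct vertices $a,b$ are adjacent if and only if $aba=a$ or $bab=b$. A tree is a connected graph without cycles; nontrivial means having at least two vertices. $\mathbb{F}_q$ denotes the field with $q$ elements. *)

theory Defs
  imports
    "Graph_Theory.Digraph_Component"
    "HOL-Algebra.Chinese_Remainder"
    "HOL-Number_Theory.Residues"
begin

definition von_neumann_regular :: "('a, 'm) ring_scheme \<Rightarrow> bool" where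
  "von_neumann_regular R \<longleftrightarrow>
     ring R \<and> (\<forall>x \<in> carrier R. \<exists>y \<in> carrier R. x \<otimes>\<^bsub>R\<^esub> y \<otimes>\<^bsub>R\<^esub> x = x)"

text \<open>Graphs are represented as symmetric digraphs: every edge occurs as two opposite arcs.\<close>

definition reg_graph :: "('a, 'm) ring_scheme \<Rightarrow> 'a pair_pre_digraph" where
  "reg_graph R =
     \<lparr> pverts = carrier R - {\<zero>\<^bsub>R\<^esub>},
       parcs = {(a, b). a \<in> carrier R - {\<zero>\<^bsub>R\<^esub>} \<and> b \<in> carrier R - {\<zero>\<^bsub>R\<^esub>} \<and> a \<noteq> b \<and>
                        (a \<otimes>\<^bsub>R\<^esub> b \<otimes>\<^bsub>R\<^esub> a = a \<or> b \<otimes>\<^bsub>R\<^esub> a \<otimes>\<^bsub>R\<^esub> b = b)} \<rparr>"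

text \<open>
  For directed graphs, \<^const>\<open>pre_digraph.cycle\<close> also counts the closed walk \<open>a, b, a\<close>, so
  \<^const>\<open>forest\<close> and \<^const>\<open>tree\<close> fail for every symmetric digraph that has an arc. The cycles of
  a simple graph are exactly the cycles of length at least 3 of its symmetric digraph.
\<close>

definition undirected_tree :: "'a pair_pre_digraph \<Rightarrow> bool" where
  "undirected_tree G \<longleftrightarrow>
     connected (with_proj G) \<and> \<not> (\<exists>p. pre_digraph.cycle (with_proj G) p \<and> 3 \<le> length p)"

lemma pair_graph_reg_graph:
  assumes "finite (carrier R)"
  shows "pair_graph (reg_graph R)"
proof
  have "parcs (reg_graph R) \<subseteq> carrier R \<times> carrier R"
    by (auto simp: reg_graph_def)
  then show "finite (parcs (reg_graph R))"
    using assms by (rule finite_subset[OF _ finite_cartesian_product]) (rule assms)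
  show "symmetric (with_proj (reg_graph R))"
    by (auto simp: symmetric_def arcs_ends_conv reg_graph_def intro!: symI)
qed (use assms in \<open>auto simp: reg_graph_def\<close>)

lemma field_residue_ring:
  assumes "prime p"
  shows "field (residue_ring (int p))" and "card (carrier (residue_ring (int p))) = p"
proof -
  interpret residues_prime p "residue_ring (int p)"
    using assms by unfold_locales
  show "field (residue_ring (int p))"
    by (rule is_field)
  show "card (carrier (residue_ring (int p))) = p"
    by (simp add: res_carrier_eq)
qed

end

theory Submission
  imports Defs
begin

text \<open>
  In a connected \<open>\<Gamma>'(R)\<close> with at least two vertices the vertex 1 has a neighbour, which must be an
  idempotent \<open>e \<noteq> 0, 1\<close>; put \<open>f = 1 - e\<close>. Short cycles then bound the corners \<open>eR\<close> and \<open>fR\<close>: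
  an idempotent \<open>g \<noteq> 0, e\<close> of \<open>eR\<close> gives the triangle \<open>1, g, e\<close>, so by regularity \<open>eR\<close> is a field;
  an \<open>x\<close> in it with inverse \<open>y \<noteq> x\<close> gives the 4-cycle \<open>x, y, x + f, y + f\<close>, so every unit of \<open>eR\<close>
  squares to \<open>e\<close> and \<open>eR = {0, e, -e}\<close>. If both corners had three elements, the sums \<open>\<plusminus>e\<close>, \<open>\<plusminus>f\<close>,
  \<open>\<plusminus>e \<plusminus> f\<close> would form an 8-cycle. Conversely, the graphs of the two product rings are paths with
  3 and 5 vertices.
\<close>

section \<open>Paths and cycles in symmetric digraphs\<close>

text \<open>\<open>connected\<close> means strong connectedness of the closure
  \<open>mk_symmetric\<close>. For a symmetric arc set, walks in that closure can be read as walks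
  in the graph itself.\<close>

lemma parcs_mk_symmetric_with_proj:
  assumes "sym (parcs G)"
  shows "parcs (mk_symmetric (with_proj G)) = parcs G"
  using assms by (auto simp: parcs_mk_symmetric dest: symD)

text \<open>A nonempty closed walk can only be based at the tail of its first arc. Fixing this base
  point removes the existential quantifier from \<open>cycle\<close>, so that an explicit list of
  arcs can be tested by simplification.\<close>

lemma cycle_with_proj_iff:
  "pre_digraph.cycle (with_proj G) p \<longleftrightarrow>
     p \<noteq> [] \<and> fst (hd p) \<in> pverts G \<and> set p \<subseteq> parcs G \<and> pcas (fst (hd p)) p (fst (hd p)) \<and>
     distinct (tl (pawalk_verts (fst (hd p)) p))"
proof -
  have "u = fst (hd p)" if "pcas u p u" "p \<noteq> []" for u
    using that by (cases p) auto
  then show ?thesis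
    by (auto simp: pre_digraph.cycle_def pre_digraph.awalk_def cas_with_proj_eq awalk_verts_with_proj_eq)
qed

lemma pcas_snd_nth:
  "pcas u p v \<Longrightarrow> Suc i < length p \<Longrightarrow> snd (p ! i) = fst (p ! Suc i)"
proof (induction p arbitrary: u i)
  case (Cons e p)
  then show ?case by (cases i; cases p) auto
qed simp

lemma pcas_last: "pcas u p v \<Longrightarrow> p \<noteq> [] \<Longrightarrow> snd (last p) = v"
  by (induction p arbitrary: u) auto

lemma tl_pawalk_verts: "pcas u p v \<Longrightarrow> tl (pawalk_verts u p) = map snd p"
proof (induction p arbitrary: u)
  case (Cons e p)
  then have "pawalk_verts (snd e) p = snd e # tl (pawalk_verts (snd e) p)"
    by (cases p) auto
  with Cons show ?case by simp
qed simp

text \<open>The heads of the arcs list each vertex of the cycle once, so a vertex is addressed by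
  the index of its incoming arc. Its predecessor and its successor in this cyclic order are the two
  neighbours sought.\<close>

lemma cycle_neighbours:
  assumes "pre_digraph.cycle (with_proj G) p" "3 \<le> length p" "v \<in> snd ` set p"
  obtains u w where "(u, v) \<in> parcs G" "(v, w) \<in> parcs G" "u \<noteq> w"
    "u \<in> snd ` set p" "w \<in> snd ` set p"
proof -
  let ?L = "length p"
  let ?u = "fst (hd p)"
  have p: "p \<noteq> []" "set p \<subseteq> parcs G" "pcas ?u p ?u" "distinct (map snd p)"
    using assms(1) tl_pawalk_verts unfolding cycle_with_proj_iff by force+
  have close: "snd (p ! (?L - 1)) = fst (p ! 0)"
    using pcas_last[OF p(3,1)] p(1) by (simp add: hd_conv_nth last_conv_nth)
  \<comment> \<open>Cyclic successor of an index: the last arc is followed by arc 0.\<close>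
  define s where "s i = (if Suc i = ?L then 0 else Suc i)" for i
  have step: "fst (p ! s i) = snd (p ! i)" and s_less: "s i < ?L" if "i < ?L" for i
  proof -
    show "fst (p ! s i) = snd (p ! i)"
    proof (cases "Suc i = ?L")
      case True
      then have "?L - 1 = i" by simp
      with close True show ?thesis by (simp add: s_def)
    next
      case False
      with that pcas_snd_nth[OF p(3), of i] show ?thesis by (simp add: s_def)
    qed
    show "s i < ?L" using that by (auto simp: s_def)
  qed
  obtain i where i: "i < ?L" "v = snd (p ! i)"
    using assms(3) by (auto simp: in_set_conv_nth)
  \<comment> \<open>Cyclic predecessor of \<open>i\<close>. It coincides with \<open>s i\<close>
    only for lengths 1 and 2, which is where the bound 3 enters.\<close>
  define j where "j = (if i = 0 then ?L - 1 else i - 1)"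
  have j: "j < ?L" "s j = i" "j \<noteq> s i"
    using i(1) assms(2) by (auto simp: j_def s_def)
  have arc: "(fst (p ! k), snd (p ! k)) \<in> parcs G" if "k < ?L" for k
    using p(2) that nth_mem by fastforce
  show ?thesis
  proof
    show "(snd (p ! j), v) \<in> parcs G"
      using arc[OF i(1)] step[OF j(1)] j(2) i(2) by metis
    show "(v, snd (p ! s i)) \<in> parcs G"
      using arc[OF s_less[OF i(1)]] step[OF i(1)] i(2) by metis
    show "snd (p ! j) \<noteq> snd (p ! s i)"
      using p(4) j s_less[OF i(1)] nth_eq_iff_index_eq[OF p(4), of j "s i"] by simp
  qed (use j(1) s_less[OF i(1)] in auto)
qed

text \<open>Here \<open>k\<close> numbers the vertices along a path. Climbing from number 0 reaches
  every vertex. On a cycle, the vertex with the largest number would have two distinct neighbours,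
  both carrying the preceding number, against injectivity of \<open>k\<close>.\<close>

lemma undirected_tree_path_graph:
  assumes bij: "bij_betw k (pverts G) {..<n::nat}" and "n > 0"
    and arcs: "\<And>a b. (a, b) \<in> parcs G \<longleftrightarrow>
      a \<in> pverts G \<and> b \<in> pverts G \<and> (k a = Suc (k b) \<or> k b = Suc (k a))"
  shows "undirected_tree G"
  unfolding undirected_tree_def
proof (intro conjI notI)
  have inj: "inj_on k (pverts G)"
    using bij by (simp add: bij_betw_def)
  have sym: "sym (parcs G)"
    by (auto simp: arcs intro: symI)
  let ?H = "mk_symmetric (with_proj G)"
  have H: "pverts ?H = pverts G" "parcs ?H = parcs G"
    using parcs_mk_symmetric_with_proj[OF sym] by simp_all
  interpret H: pair_sym_digraph ?H
    using sym by unfold_locales (auto simp: H symmetric_def arcs simp del: pverts_mk_symmetric)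
  define r where "r = inv_into (pverts G) k"
  have r: "r i \<in> pverts G" "k (r i) = i" if "i < n" for i
    using that bij unfolding r_def bij_betw_def by (auto intro: inv_into_into f_inv_into_f)
  have from0: "r 0 \<rightarrow>\<^sup>*\<^bsub>with_proj ?H\<^esub> r i" if "i < n" for i
    using that
  proof (induction i)
    case 0
    then show ?case using r(1)[OF 0] by (simp add: H.reachable_refl)
  next
    case (Suc i)
    then have "(r i, r (Suc i)) \<in> parcs ?H"
      using r[of i] r[OF Suc.prems] by (simp add: H arcs)
    with Suc show ?case
      by (metis H.reachable_adj_trans Suc_lessD)
  qed
  have rk: "r (k v) = v" "k v < n" if "v \<in> pverts G" for v
    using that bij inj unfolding r_def bij_betw_def by auto
  \<comment> \<open>By symmetry \<open>u\<close> is joined to \<open>v\<close> through the end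
    \<open>r 0\<close> of the path.\<close>
  have "u \<rightarrow>\<^sup>*\<^bsub>with_proj ?H\<^esub> v" if "u \<in> pverts G" "v \<in> pverts G" for u v
    using from0[of "k u"] from0[of "k v"] rk that H.symmetric_reachable' H.reachable_trans by metis
  moreover have "pverts G \<noteq> {}"
    using r(1)[OF \<open>n > 0\<close>] by auto
  ultimately show "connected (with_proj G)"
    unfolding connected_def strongly_connected_def by simp
next
  assume "\<exists>p. pre_digraph.cycle (with_proj G) p \<and> 3 \<le> length p"
  then obtain p where p: "pre_digraph.cycle (with_proj G) p" "3 \<le> length p"
    by blast
  let ?K = "k ` snd ` set p"
  have K: "finite ?K" "?K \<noteq> {}"
    using p(2) by auto
  obtain v where v: "v \<in> snd ` set p" "k v = Max ?K"
    using Max_in[OF K] by (metis (no_types, lifting) imageE)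
  have max: "k w \<le> k v" if "w \<in> snd ` set p" for w
    using Max_ge[OF K(1)] v(2) that by simp
  obtain u w where "(u, v) \<in> parcs G" "(v, w) \<in> parcs G" "u \<noteq> w"
    "u \<in> snd ` set p" "w \<in> snd ` set p"
    using cycle_neighbours[OF p v(1)] by blast
  then show False
    using max[of u] max[of w] bij arcs unfolding bij_betw_def inj_on_def by fastforce
qed

text \<open>A walk from \<open>u\<close> to a different vertex has a first arc, and this arc leaves
  \<open>u\<close>.\<close>

lemma neighbour_of_connected:
  assumes "connected (with_proj G)" "sym (parcs G)" "u \<in> pverts G" "v \<in> pverts G" "u \<noteq> v"
  obtains w where "(u, w) \<in> parcs G"
proof -
  have "u \<rightarrow>\<^sup>*\<^bsub>with_proj (mk_symmetric (with_proj G))\<^esub> v"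
    using assms(1,3,4) by (auto simp: connected_def strongly_connected_def)
  then show ?thesis
    using assms(5) parcs_mk_symmetric_with_proj[OF assms(2)] that
    by (cases rule: pre_digraph.converse_reachable_cases) auto
qed

section \<open>Corners of a ring split by two orthogonal idempotents\<close>

text \<open>For an idempotent \<open>e\<close> this is the ideal \<open>eR\<close>, encoded by its
  fixed-point equation so that membership is an identity usable for rewriting.\<close>

definition corner :: "('a, 'm) ring_scheme \<Rightarrow> 'a \<Rightarrow> 'a set" where
  "corner R e = {x \<in> carrier R. e \<otimes>\<^bsub>R\<^esub> x = x}"

text \<open>This is the decomposition of \<open>R\<close> as \<open>eR\<close> times
  \<open>fR\<close> with both factors nonzero; idempotence is derived in \<open>e_idem\<close>. The
  assumptions are symmetric in \<open>e\<close> and \<open>f\<close>, so \<open>swap\<close> carries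
  each result over to the other corner.\<close>

locale idempotent_splitting = cring R for R (structure) +
  fixes e f
  assumes e_closed [simp]: "e \<in> carrier R" and f_closed [simp]: "f \<in> carrier R"
    and orthogonal: "e \<otimes> f = \<zero>" and complete: "e \<oplus> f = \<one>"
    and e_nonzero: "e \<noteq> \<zero>" and f_nonzero: "f \<noteq> \<zero>"
begin

lemma swap: "idempotent_splitting R f e"
  using orthogonal complete e_nonzero f_nonzero
  by unfold_locales (simp_all add: m_comm a_comm)

lemma e_idem: "e \<otimes> e = e"
proof -
  have "e \<otimes> (e \<oplus> f) = e \<otimes> e"
    by (simp add: r_distr orthogonal)
  then show ?thesis by (simp add: complete)
qed

lemma f_idem: "f \<otimes> f = f"
  using idempotent_splitting.e_idem[OF swap] .

lemma decompose:
  assumes "x \<in> carrier R"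
  shows "(e \<otimes> x) \<oplus> (f \<otimes> x) = x"
  using l_distr[of e f x] assms by (simp add: complete)

lemma corner_closed:
  "x \<in> corner R e \<Longrightarrow> x \<in> carrier R" "y \<in> corner R f \<Longrightarrow> y \<in> carrier R"
  by (auto simp: corner_def)

lemma mult_in_corner:
  assumes "x \<in> carrier R"
  shows "e \<otimes> x \<in> corner R e" "f \<otimes> x \<in> corner R f"
  using assms e_idem f_idem by (auto simp: corner_def m_assoc[symmetric])

lemma corner_mult:
  assumes "a \<in> corner R e" "b \<in> corner R f"
  shows "a \<otimes> b = \<zero>" "b \<otimes> a = \<zero>"
proof -
  have ab: "a \<in> carrier R" "b \<in> carrier R" "e \<otimes> a = a" "f \<otimes> b = b"
    using assms by (auto simp: corner_def)
  have "(e \<otimes> a) \<otimes> (f \<otimes> b) = (e \<otimes> f) \<otimes> (a \<otimes> b)"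
    using ab(1,2) by (simp add: m_assoc m_lcomm)
  then show "a \<otimes> b = \<zero>"
    using ab by (simp add: orthogonal)
  then show "b \<otimes> a = \<zero>"
    using ab by (simp add: m_comm)
qed

lemma corner_simps [simp]:
  "\<zero> \<in> corner R e" "\<zero> \<in> corner R f" "e \<in> corner R e" "f \<in> corner R f"
  "x \<in> corner R e \<Longrightarrow> \<ominus> x \<in> corner R e" "y \<in> corner R f \<Longrightarrow> \<ominus> y \<in> corner R f"
  by (auto simp: corner_def e_idem f_idem r_minus)

lemma corner_sum_mult:
  assumes "a \<in> corner R e" "b \<in> corner R f" "c \<in> corner R e" "d \<in> corner R f"
  shows "(a \<oplus> b) \<otimes> (c \<oplus> d) = a \<otimes> c \<oplus> b \<otimes> d"
  using assms corner_closed by (simp add: l_distr r_distr corner_mult)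

text \<open>Multiplication by \<open>e\<close> and by \<open>f\<close> gives the two projections of
  the decomposition; hence the representation of an element as a sum of corner elements is
  unique.\<close>

lemma proj_corner_sum:
  assumes "a \<in> corner R e" "b \<in> corner R f"
  shows "e \<otimes> (a \<oplus> b) = a" "f \<otimes> (a \<oplus> b) = b"
proof -
  have "a \<in> carrier R" "b \<in> carrier R" "e \<otimes> a = a" "f \<otimes> b = b" "e \<otimes> b = \<zero>" "f \<otimes> a = \<zero>"
    using assms corner_mult(1)[OF corner_simps(3) assms(2)] corner_mult(2)[OF assms(1) corner_simps(4)]
    unfolding corner_def by simp_all
  then show "e \<otimes> (a \<oplus> b) = a" "f \<otimes> (a \<oplus> b) = b"
    by (simp_all add: r_distr)
qed

lemma corner_sum_eq_iff:
  assumes "a \<in> corner R e" "b \<in> corner R f" "c \<in> corner R e" "d \<in> corner R f"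
  shows "a \<oplus> b = c \<oplus> d \<longleftrightarrow> a = c \<and> b = d"
  using proj_corner_sum[of a b] proj_corner_sum[of c d] assms by metis

lemma corner_sum_zero_iff:
  assumes "a \<in> corner R e" "b \<in> corner R f"
  shows "a \<oplus> b = \<zero> \<longleftrightarrow> a = \<zero> \<and> b = \<zero>"
  using corner_sum_eq_iff[OF assms, of \<zero> \<zero>] by simp

lemma corner_mult_closed:
  "a \<in> corner R e \<Longrightarrow> c \<in> corner R e \<Longrightarrow> a \<otimes> c \<in> corner R e"
  "b \<in> corner R f \<Longrightarrow> d \<in> corner R f \<Longrightarrow> b \<otimes> d \<in> corner R f"
  by (auto simp: corner_def m_assoc[symmetric])

text \<open>Products are computed componentwise, but the disjunction is not split: the same one of
  the two equations must hold in both corners.\<close>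

lemma reg_graph_arc_iff:
  assumes "a \<in> corner R e" "b \<in> corner R f" "c \<in> corner R e" "d \<in> corner R f"
  shows "(a \<oplus> b, c \<oplus> d) \<in> parcs (reg_graph R) \<longleftrightarrow>
    (a \<noteq> \<zero> \<or> b \<noteq> \<zero>) \<and> (c \<noteq> \<zero> \<or> d \<noteq> \<zero>) \<and> (a \<noteq> c \<or> b \<noteq> d) \<and>
    (a \<otimes> c \<otimes> a = a \<and> b \<otimes> d \<otimes> b = b \<or> c \<otimes> a \<otimes> c = c \<and> d \<otimes> b \<otimes> d = d)"
  using assms corner_closed
  by (simp add: reg_graph_def corner_sum_mult corner_mult_closed corner_sum_eq_iff corner_sum_zero_iff)

end

section \<open>Integer multiples of an idempotent and cyclic corners\<close>

context cring begin

lemma add_pow_int_0: "add_pow R (0::int) x = \<zero>"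
  by (simp add: add_pow_int_ge)

lemma add_pow_int_mod:
  assumes "x \<in> carrier R" "add_pow R (m::int) x = \<zero>"
  shows "add_pow R (k mod m) x = add_pow R k x"
proof -
  have "add_pow R k x = add_pow R (m * (k div m) + k mod m) x" by simp
  also have "\<dots> = add_pow R (m * (k div m)) x \<oplus> add_pow R (k mod m) x"
    using assms(1) by (rule add.int_pow_mult)
  also have "add_pow R (m * (k div m)) x = \<zero>"
    using assms add.int_pow_pow[OF assms(1), of "k div m" m]
    by (simp add: add.int_pow_one mult.commute)
  finally show ?thesis
    using assms(1) by simp
qed

lemma add_pow_int_idem_mult:
  assumes "x \<in> carrier R" "x \<otimes> x = x"
  shows "add_pow R (i::int) x \<otimes> add_pow R (j::int) x = add_pow R (i * j) x"
  using assms by (simp add: add_pow_ldistr_int add_pow_rdistr_int add.int_pow_pow mult.commute)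

text \<open>The hypotheses make \<open>m\<close> the exact additive order of \<open>x\<close>. The
  difference \<open>i - j\<close>, reduced modulo \<open>m\<close>, still annihilates
  \<open>x\<close>, so minimality of \<open>m\<close> forces it to be 0.\<close>

lemma add_pow_int_eq_imp_eq:
  assumes "x \<in> carrier R" "add_pow R (m::int) x = \<zero>"
    and "\<And>k. 0 < k \<Longrightarrow> k < m \<Longrightarrow> add_pow R k x \<noteq> \<zero>"
    and "i \<in> {0..<m}" "j \<in> {0..<m}" "add_pow R i x = add_pow R j x"
  shows "i = j"
proof -
  have "add_pow R ((i - j) mod m) x = add_pow R (i - j) x"
    using assms by (simp add: add_pow_int_mod)
  also have "\<dots> = add_pow R i x \<oplus> add_pow R (- j) x"
    using add.int_pow_mult[OF assms(1), of i "- j"] by simp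
  also have "\<dots> = \<zero>"
    using assms by (simp add: add.int_pow_neg r_neg)
  finally have "(i - j) mod m = 0"
    using assms(3)[of "(i - j) mod m"] assms(4)
      pos_mod_sign[of m "i - j"] pos_mod_bound[of m "i - j"] by fastforce
  then show ?thesis
    using assms(4,5) mod_eq_dvd_iff[of i m j] by (auto simp: dvd_eq_mod_eq_0)
qed

end

text \<open>For an idempotent \<open>e\<close> this expresses that \<open>eR\<close> is a copy of
  the integers modulo \<open>m\<close>: the identity \<open>e\<close> of the corner has additive
  order exactly \<open>m\<close> and generates it additively.\<close>

definition cyclic_corner :: "('a, 'm) ring_scheme \<Rightarrow> 'a \<Rightarrow> int \<Rightarrow> bool" where
  "cyclic_corner R e m \<longleftrightarrow> 1 < m \<and> add_pow R m e = \<zero>\<^bsub>R\<^esub> \<and>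
     (\<forall>k. 0 < k \<longrightarrow> k < m \<longrightarrow> add_pow R k e \<noteq> \<zero>\<^bsub>R\<^esub>) \<and>
     corner R e \<subseteq> (\<lambda>k. add_pow R k e) ` {0..<m}"

context idempotent_splitting begin

lemma add_pow_corner:
  "add_pow R (k::int) e \<in> corner R e" "add_pow R (k::int) f \<in> corner R f"
  by (simp_all add: corner_def add_pow_rdistr_int e_idem f_idem)

text \<open>The map \<open>h\<close> sends \<open>(a, b)\<close> to \<open>a\<close> times
  \<open>e\<close> plus \<open>b\<close> times \<open>f\<close>. Orthogonality and idempotence make
  it multiplicative, the exact orders make it injective, and generation of the corners makes it
  surjective. It runs from the product to \<open>R\<close> and is inverted at the end.\<close>

lemma iso_residue_rings:
  assumes "cyclic_corner R e m" "cyclic_corner R f n"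
  shows "R \<simeq> RDirProd (residue_ring m) (residue_ring n)"
proof -
  let ?S = "RDirProd (residue_ring m) (residue_ring n)"
  define h where "h = (\<lambda>(a :: int, b :: int). add_pow R a e \<oplus> add_pow R b f)"
  have m: "1 < m" "add_pow R m e = \<zero>" and e_ord: "\<And>k. 0 < k \<Longrightarrow> k < m \<Longrightarrow> add_pow R k e \<noteq> \<zero>"
    and e_gen: "corner R e \<subseteq> (\<lambda>k. add_pow R k e) ` {0..<m}"
    and n: "1 < n" "add_pow R n f = \<zero>" and f_ord: "\<And>k. 0 < k \<Longrightarrow> k < n \<Longrightarrow> add_pow R k f \<noteq> \<zero>"
    and f_gen: "corner R f \<subseteq> (\<lambda>k. add_pow R k f) ` {0..<n}"
    using assms unfolding cyclic_corner_def by auto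
  interpret S1: residues m "residue_ring m" by unfold_locales (use m in auto)
  interpret S2: residues n "residue_ring n" by unfold_locales (use n in auto)
  have "ring ?S"
    by (intro RDirProd_ring cring.axioms(1) S1.cring S2.cring)
  have carrier: "carrier ?S = {0..<m} \<times> {0..<n}"
    by (auto simp: RDirProd_carrier residue_ring_def)
  have mult: "(a, b) \<otimes>\<^bsub>?S\<^esub> (c, d) = (a * c mod m, b * d mod n)"
    and add: "(a, b) \<oplus>\<^bsub>?S\<^esub> (c, d) = (((a + c) mod m), ((b + d) mod n))"
    and one: "\<one>\<^bsub>?S\<^esub> = (1, 1)" for a b c d
    by (simp_all add: RDirProd_def DirProd_def monoid.defs residue_ring_def)
  have "h \<in> ring_iso ?S R"
  proof (rule ring_iso_memI)
    show "h \<one>\<^bsub>?S\<^esub> = \<one>"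
      by (simp add: h_def one complete)
    show "h x \<in> carrier R" for x
      by (simp add: h_def split: prod.split)
    show "h (x \<otimes>\<^bsub>?S\<^esub> y) = h x \<otimes> h y" for x y
      by (cases x; cases y) (simp add: h_def mult corner_sum_mult add_pow_corner
          add_pow_int_idem_mult e_idem f_idem add_pow_int_mod m n)
    show "h (x \<oplus>\<^bsub>?S\<^esub> y) = h x \<oplus> h y" for x y
      by (cases x; cases y) (simp add: h_def add add_pow_int_mod m n
          add.int_pow_mult a_ac)
    show "bij_betw h (carrier ?S) (carrier R)"
    proof (rule bij_betw_imageI)
      show "inj_on h (carrier ?S)"
      proof (rule inj_onI)
        fix x y assume xy: "x \<in> carrier ?S" "y \<in> carrier ?S" "h x = h y"
        obtain a b c d where ab: "x = (a, b)" "y = (c, d)"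
          by (cases x, cases y) blast
        have "add_pow R a e = add_pow R c e" "add_pow R b f = add_pow R d f"
          using xy(3) by (simp_all add: h_def ab corner_sum_eq_iff add_pow_corner)
        then have "a = c" "b = d"
          using add_pow_int_eq_imp_eq[OF e_closed m(2) e_ord, of a c]
            add_pow_int_eq_imp_eq[OF f_closed n(2) f_ord, of b d] xy(1,2)
          unfolding carrier ab by blast+
        then show "x = y" by (simp add: ab)
      qed
      show "h ` carrier ?S = carrier R"
      proof
        show "h ` carrier ?S \<subseteq> carrier R"
          by (auto simp: h_def)
        show "carrier R \<subseteq> h ` carrier ?S"
        proof
          fix x assume x: "x \<in> carrier R"
          obtain i where "i \<in> {0..<m}" "e \<otimes> x = add_pow R i e"
            using mult_in_corner(1)[OF x] e_gen by auto
          moreover obtain j where "j \<in> {0..<n}" "f \<otimes> x = add_pow R j f"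
            using mult_in_corner(2)[OF x] f_gen by auto
          ultimately show "x \<in> h ` carrier ?S"
            using decompose[OF x] unfolding carrier h_def by force
        qed
      qed
    qed
  qed
  then show ?thesis
    using ring_iso_sym[OF \<open>ring ?S\<close>] unfolding is_ring_iso_def by blast
qed

lemma cyclic_corner_2:
  assumes "corner R e \<subseteq> {\<zero>, e, \<ominus> e}" "\<ominus> e = e"
  shows "cyclic_corner R e 2"
proof -
  have "add_pow R (2::int) e = e \<oplus> e"
    using add.int_pow_mult[OF e_closed, of 1 1] by simp
  also have "\<dots> = \<zero>"
    using assms(2) l_neg[OF e_closed] by simp
  finally have "add_pow R (2::int) e = \<zero>" .
  moreover have "add_pow R k e \<noteq> \<zero>" if "0 < k" "k < 2" for k :: int
  proof -
    have "k = 1" using that by simp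
    then show ?thesis using e_nonzero by simp
  qed
  moreover have "{0..<2} = {0, 1 :: int}"
    by auto
  ultimately show ?thesis
    using assms e_nonzero unfolding cyclic_corner_def by (auto simp: add_pow_int_0)
qed

lemma cyclic_corner_3:
  assumes "corner R e \<subseteq> {\<zero>, e, \<ominus> e}" "\<ominus> e \<noteq> e"
  shows "cyclic_corner R e 3"
proof -
  have two: "add_pow R (2::int) e = e \<oplus> e"
    using add.int_pow_mult[OF e_closed, of 1 1] by simp
  then have "e \<oplus> e \<in> corner R e"
    using add_pow_corner(1)[of 2] by simp
  moreover have "e \<oplus> e \<noteq> \<zero>"
    using assms(2) minus_equality[of e e] by auto
  moreover have "e \<oplus> e \<noteq> e"
    using e_nonzero add.r_cancel_one' e_closed by metis
  moreover have "\<ominus> e \<noteq> \<zero>"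
    using e_nonzero minus_minus[OF e_closed] by auto
  \<comment> \<open>The double of \<open>e\<close> lies in the corner and is neither 0 nor
    \<open>e\<close>, which leaves only \<open>\<ominus> e\<close>.\<close>
  ultimately have neg: "add_pow R (2::int) e = \<ominus> e" "\<ominus> e \<noteq> \<zero>"
    using assms(1) two by auto
  have "add_pow R (3::int) e = add_pow R (2::int) e \<oplus> e"
    using add.int_pow_mult[OF e_closed, of 2 1] by simp
  also have "\<dots> = \<zero>"
    by (simp add: neg(1) l_neg)
  finally have "add_pow R (3::int) e = \<zero>" .
  moreover have "{0..<3} = {0, 1, 2 :: int}"
    by auto
  moreover have "add_pow R k e \<noteq> \<zero>" if "0 < k" "k < 3" for k :: int
  proof -
    have "k = 1 \<or> k = 2" using that by auto
    then show ?thesis using e_nonzero neg by (metis add.int_pow_1 e_closed)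
  qed
  ultimately show ?thesis
    using assms e_nonzero neg unfolding cyclic_corner_def by (auto simp: add_pow_int_0)
qed

end

section \<open>Rings whose graph is a tree\<close>

lemma sym_parcs_reg_graph: "sym (parcs (reg_graph R))"
  by (auto simp: reg_graph_def intro: symI)

lemma (in cring) splitting_of_idempotent:
  assumes "e \<in> carrier R" "e \<otimes> e = e" "e \<noteq> \<zero>" "e \<noteq> \<one>"
  shows "idempotent_splitting R e (\<one> \<ominus> e)"
proof
  show "e \<otimes> (\<one> \<ominus> e) = \<zero>"
    using assms by (simp add: minus_eq r_distr r_minus r_neg)
  show "e \<oplus> (\<one> \<ominus> e) = \<one>"
    using assms(1) by algebra
  show "\<one> \<ominus> e \<noteq> \<zero>"
    using assms(1,4) by simp
qed (use assms in auto)

text \<open>For a neighbour \<open>e\<close> of 1, the equation \<open>1 e 1 = 1\<close> would give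
  \<open>e = 1\<close>; so the other one, \<open>e 1 e = e\<close>, holds and \<open>e\<close> is
  idempotent.\<close>

lemma (in cring) splitting_of_connected:
  assumes "connected (with_proj (reg_graph R))" "2 \<le> card (pverts (reg_graph R))"
  obtains e f where "idempotent_splitting R e f"
proof -
  \<comment> \<open>That 1 is a vertex is not yet known at this point, hence the case split; it
    follows once a nonzero \<open>x\<close> has been found.\<close>
  have "card (pverts (reg_graph R) - {\<one>}) > 0"
    using assms(2) by (cases "\<one> \<in> pverts (reg_graph R)") (auto simp: card_Diff_singleton_if)
  then obtain x where x: "x \<in> carrier R" "x \<noteq> \<zero>" "x \<noteq> \<one>"
    by (auto simp: card_gt_0_iff reg_graph_def)
  then have "\<one> \<noteq> \<zero>"
    using r_one r_null by metis
  then obtain e where "(\<one>, e) \<in> parcs (reg_graph R)"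
    using neighbour_of_connected[OF assms(1) sym_parcs_reg_graph, of \<one> x] x
    by (auto simp: reg_graph_def)
  then have "e \<in> carrier R" "e \<otimes> e = e" "e \<noteq> \<zero>" "e \<noteq> \<one>"
    by (auto simp: reg_graph_def)
  then show ?thesis
    using splitting_of_idempotent that by blast
qed

section \<open>Bounding the corners by excluding short cycles\<close>

locale tree_splitting = idempotent_splitting +
  assumes regular: "von_neumann_regular R" and tree: "undirected_tree (reg_graph R)"
begin

lemma swap_tree: "tree_splitting R f e"
  using swap regular tree by (simp add: tree_splitting_def tree_splitting_axioms_def)

lemma no_cycle:
  assumes "pre_digraph.cycle (with_proj (reg_graph R)) p" "3 \<le> length p"
  shows False
  using assms tree unfolding undirected_tree_def by blast

lemma idempotent_in_corner:
  assumes "g \<in> corner R e" "g \<otimes> g = g" "g \<noteq> \<zero>"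
  shows "g = e"
proof (rule ccontr)
  assume "g \<noteq> e"
  have eg: "e \<otimes> g = g" and g: "g \<in> carrier R"
    using assms(1) by (auto simp: corner_def)
  then have ge: "g \<otimes> e = g"
    by (simp add: m_comm)
  \<comment> \<open>The triangle 1, \<open>g\<close>, \<open>e\<close>, with 1 written as
    \<open>e \<oplus> f\<close>. The zero summands keep each vertex in the form that
    \<open>reg_graph_arc_iff\<close> expects, so \<open>r_zero\<close> is withheld from the
    simplifier.\<close>
  let ?p = "[(e \<oplus> f, g \<oplus> \<zero>), (g \<oplus> \<zero>, e \<oplus> \<zero>), (e \<oplus> \<zero>, e \<oplus> f)]"
  have "set ?p \<subseteq> parcs (reg_graph R)"
    using \<open>g \<noteq> e\<close> assms eg ge e_nonzero f_nonzero
    by (simp add: reg_graph_arc_iff e_idem del: r_zero)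
  moreover have "distinct (map snd ?p)"
    using \<open>g \<noteq> e\<close> assms(1) f_nonzero by (simp add: corner_sum_eq_iff del: r_zero)
  ultimately have "pre_digraph.cycle (with_proj (reg_graph R)) ?p"
    unfolding cycle_with_proj_iff by (auto simp: reg_graph_def simp del: r_zero)
  then show False
    by (rule no_cycle) simp
qed

text \<open>If \<open>x z x = x\<close>, then \<open>x z\<close> is a nonzero idempotent of the
  corner and therefore equals \<open>e\<close>. Replacing \<open>z\<close> by \<open>e z\<close>
  moves the inverse into the corner without changing the product.\<close>

lemma corner_inverse:
  assumes "x \<in> corner R e" "x \<noteq> \<zero>"
  obtains y where "y \<in> corner R e" "x \<otimes> y = e"
proof -
  have x: "x \<in> carrier R" "e \<otimes> x = x"
    using assms(1) by (auto simp: corner_def)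
  obtain z where z: "z \<in> carrier R" "x \<otimes> z \<otimes> x = x"
    using regular x(1) unfolding von_neumann_regular_def by blast
  have xz: "x \<otimes> (e \<otimes> z) = x \<otimes> z"
    using x z(1) by (metis e_closed m_assoc m_comm)
  have "x \<otimes> z \<otimes> (x \<otimes> z) = x \<otimes> z"
    using x(1) z by (metis m_assoc m_closed)
  moreover have "x \<otimes> z \<in> corner R e"
    using x z(1) by (simp add: corner_def m_assoc[symmetric])
  moreover have "x \<otimes> z \<noteq> \<zero>"
    using x(1) z(2) assms(2) by auto
  ultimately have "x \<otimes> z = e"
    using idempotent_in_corner by blast
  then show ?thesis
    using that[of "e \<otimes> z"] mult_in_corner(1)[OF z(1)] xz by simp
qed

lemma corner_square:
  assumes "x \<in> corner R e" "x \<noteq> \<zero>"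
  shows "x \<otimes> x = e"
proof (rule ccontr)
  assume nsq: "x \<otimes> x \<noteq> e"
  obtain y where y: "y \<in> corner R e" "x \<otimes> y = e"
    using corner_inverse[OF assms] .
  have cl: "x \<in> carrier R" "y \<in> carrier R" "e \<otimes> x = x" "e \<otimes> y = y"
    using assms(1) y(1) by (auto simp: corner_def)
  have yx: "y \<otimes> x = e"
    using y(2) cl by (simp add: m_comm)
  have "x \<noteq> y" "y \<noteq> \<zero>"
    using nsq y cl e_nonzero by auto
  \<comment> \<open>Each edge uses \<open>x y x = x\<close> or \<open>y x y = y\<close> in the first
    corner. In the second corner, 0 absorbs either value and \<open>f\<close> is paired with
    itself.\<close>
  let ?p = "[(x \<oplus> \<zero>, y \<oplus> \<zero>), (y \<oplus> \<zero>, x \<oplus> f), (x \<oplus> f, y \<oplus> f), (y \<oplus> f, x \<oplus> \<zero>)]"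
  have "set ?p \<subseteq> parcs (reg_graph R)"
    using \<open>x \<noteq> y\<close> \<open>y \<noteq> \<zero>\<close> assms y yx f_nonzero cl
    by (simp add: reg_graph_arc_iff f_idem del: r_zero)
  moreover have "distinct (map snd ?p)"
    using \<open>x \<noteq> y\<close> assms(1) y(1) f_nonzero f_nonzero[symmetric]
    by (simp add: corner_sum_eq_iff del: r_zero)
  ultimately have "pre_digraph.cycle (with_proj (reg_graph R)) ?p"
    unfolding cycle_with_proj_iff by (auto simp: reg_graph_def simp del: r_zero)
  then show False
    by (rule no_cycle) simp
qed

text \<open>For \<open>x\<close> other than 0 and \<open>e\<close>, both \<open>x\<close> and
  \<open>x - e\<close> square to \<open>e\<close>. Hence \<open>(x - e)(x + e) = 0\<close>, and
  multiplying by \<open>x - e\<close> cancels the first factor, leaving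
  \<open>x + e = 0\<close>.\<close>

lemma corner_subset: "corner R e \<subseteq> {\<zero>, e, \<ominus> e}"
proof
  fix x assume x: "x \<in> corner R e"
  then have cl: "x \<in> carrier R" "e \<otimes> x = x"
    by (auto simp: corner_def)
  show "x \<in> {\<zero>, e, \<ominus> e}"
  proof (cases "x = \<zero> \<or> x = e")
    case False
    have d: "x \<ominus> e \<in> corner R e"
      using cl by (simp add: corner_def minus_eq r_distr r_minus e_idem)
    have "x \<ominus> e \<noteq> \<zero>"
      using False cl by simp
    then have "(x \<ominus> e) \<otimes> (x \<ominus> e) = e"
      using corner_square[OF d] by blast
    moreover have "(x \<ominus> e) \<otimes> (x \<oplus> e) = \<zero>"
      using corner_square[OF x] False cl
      by (simp add: minus_eq l_distr r_distr l_minus m_comm[of x e] e_idem a_assoc r_neg r_neg1 r_neg2)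
    ultimately have "e \<otimes> (x \<oplus> e) = \<zero>"
      using cl(1) by (metis e_closed a_closed m_assoc minus_closed r_null)
    then have "x \<oplus> e = \<zero>"
      using cl by (simp add: r_distr e_idem)
    then show ?thesis
      using minus_equality[of x e] cl by simp
  qed auto
qed

lemma neg_eq_self: "\<ominus> e = e \<or> \<ominus> f = f"
proof (rule ccontr)
  assume "\<not> ?thesis"
  then have neq: "\<ominus> e \<noteq> e" "\<ominus> f \<noteq> f" "e \<noteq> \<ominus> e" "f \<noteq> \<ominus> f"
    by auto
  have "\<ominus> e \<noteq> \<zero>" "\<ominus> f \<noteq> \<zero>"
    using e_nonzero f_nonzero minus_minus[OF e_closed] minus_minus[OF f_closed] by auto
  note nz = this this[symmetric] e_nonzero f_nonzero e_nonzero[symmetric] f_nonzero[symmetric]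
  \<comment> \<open>The list alternates between elements of a single corner and full sums. An
    element of a single corner is adjacent to a sum that contains it, since \<open>e\<close> and
    \<open>\<ominus> e\<close> equal their own cubes, and likewise for \<open>f\<close>. Zipping
    with the rotated list gives the arcs of the closed walk.\<close>
  let ?vs = "[e \<oplus> \<zero>, e \<oplus> f, \<zero> \<oplus> f, \<ominus> e \<oplus> f, \<ominus> e \<oplus> \<zero>, \<ominus> e \<oplus> \<ominus> f, \<zero> \<oplus> \<ominus> f, e \<oplus> \<ominus> f]"
  let ?p = "zip ?vs (tl ?vs @ [hd ?vs])"
  have "set ?p \<subseteq> parcs (reg_graph R)"
    using neq nz
    by (simp add: reg_graph_arc_iff e_idem f_idem l_minus r_minus del: r_zero l_zero)
  moreover have "distinct (map snd ?p)"
    using neq nz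
    by (simp add: corner_sum_eq_iff del: r_zero l_zero)
  ultimately have "pre_digraph.cycle (with_proj (reg_graph R)) ?p"
    unfolding cycle_with_proj_iff by (auto simp: reg_graph_def simp del: r_zero l_zero)
  then show False
    by (rule no_cycle) simp
qed

lemma cyclic_corner:
  "cyclic_corner R e (if \<ominus> e = e then 2 else 3)"
  using cyclic_corner_2[OF corner_subset] cyclic_corner_3[OF corner_subset] by simp

text \<open>At least one corner has order 2; if it is the second one, \<open>swap\<close> puts it
  first, so the case of orders 3 and 2 is absorbed.\<close>

lemma iso_cases:
  "R \<simeq> RDirProd (residue_ring 2) (residue_ring 2) \<or>
   R \<simeq> RDirProd (residue_ring 2) (residue_ring 3)"
  using neg_eq_self cyclic_corner tree_splitting.cyclic_corner[OF swap_tree]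
    iso_residue_rings idempotent_splitting.iso_residue_rings[OF swap]
  by (metis (full_types))

end

section \<open>The graphs of the two product rings\<close>

lemma reg_graph_arc_iso:
  assumes "ring R" "ring S" and h: "h \<in> ring_iso R S"
  shows "bij_betw h (pverts (reg_graph R)) (pverts (reg_graph S))"
    and "a \<in> carrier R \<Longrightarrow> b \<in> carrier R \<Longrightarrow>
      (a, b) \<in> parcs (reg_graph R) \<longleftrightarrow> (h a, h b) \<in> parcs (reg_graph S)"
proof -
  interpret R: ring R by fact
  interpret S: ring S by fact
  have bij: "bij_betw h (carrier R) (carrier S)" and hom: "h \<in> ring_hom R S"
    using h by (auto simp: ring_iso_def)
  have inj: "inj_on h (carrier R)"
    using bij by (simp add: bij_betw_def)
  have zero: "h \<zero>\<^bsub>R\<^esub> = \<zero>\<^bsub>S\<^esub>"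
    using ring_hom_zero[OF hom \<open>ring R\<close> \<open>ring S\<close>] .
  show "bij_betw h (pverts (reg_graph R)) (pverts (reg_graph S))"
    using bij_betw_DiffI[OF bij, of "{\<zero>\<^bsub>R\<^esub>}" "{\<zero>\<^bsub>S\<^esub>}"] zero
    by (simp add: reg_graph_def bij_betw_def)
  assume ab: "a \<in> carrier R" "b \<in> carrier R"
  note inj_iff = inj_on_eq_iff[OF inj]
  show "(a, b) \<in> parcs (reg_graph R) \<longleftrightarrow> (h a, h b) \<in> parcs (reg_graph S)"
    using ab ring_hom_closed[OF hom]
    by (simp add: reg_graph_def zero[symmetric] inj_iff ring_hom_mult[OF hom, symmetric])
qed

text \<open>A ring isomorphism preserves zero and the equations defining adjacency, so a path
  numbering of the graph of \<open>S\<close> can be pulled back to \<open>R\<close>.\<close>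

lemma reg_graph_iso_path:
  assumes "ring R" "ring S" "R \<simeq> S"
    and k: "bij_betw k (pverts (reg_graph S)) {..<n::nat}"
    and arcs: "\<And>a b. a \<in> pverts (reg_graph S) \<Longrightarrow> b \<in> pverts (reg_graph S) \<Longrightarrow>
      (a, b) \<in> parcs (reg_graph S) \<longleftrightarrow> k a = Suc (k b) \<or> k b = Suc (k a)"
    and n: "2 \<le> n"
  shows "undirected_tree (reg_graph R) \<and> 2 \<le> card (pverts (reg_graph R))"
proof -
  obtain h where h: "h \<in> ring_iso R S"
    using assms(3) unfolding is_ring_iso_def by blast
  note iso = reg_graph_arc_iso[OF assms(1,2) h]
  have bij: "bij_betw (k \<circ> h) (pverts (reg_graph R)) {..<n}"
    using bij_betw_trans[OF iso(1) k] .
  have verts: "pverts (reg_graph R) \<subseteq> carrier R"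
    by (auto simp: reg_graph_def)
  have "(a, b) \<in> parcs (reg_graph R) \<longleftrightarrow> a \<in> pverts (reg_graph R) \<and> b \<in> pverts (reg_graph R) \<and>
      ((k \<circ> h) a = Suc ((k \<circ> h) b) \<or> (k \<circ> h) b = Suc ((k \<circ> h) a))" for a b
  proof (cases "a \<in> pverts (reg_graph R) \<and> b \<in> pverts (reg_graph R)")
    case True
    then have "h a \<in> pverts (reg_graph S)" "h b \<in> pverts (reg_graph S)"
      using iso(1) by (auto simp: bij_betw_def)
    then show ?thesis
      using True iso(2)[of a b] arcs[of "h a" "h b"] verts by auto
  next
    case False
    then show ?thesis by (auto simp: reg_graph_def)
  qed
  then have "undirected_tree (reg_graph R)"
    using undirected_tree_path_graph[OF bij] n by simp
  then show ?thesis
    using bij_betw_same_card[OF bij] n by simp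
qed

lemma ring_RDirProd_residue:
  assumes "1 < m" "1 < n"
  shows "ring (RDirProd (residue_ring m) (residue_ring n))"
proof -
  interpret m: residues m "residue_ring m" by unfold_locales (rule assms)
  interpret n: residues n "residue_ring n" by unfold_locales (rule assms)
  show ?thesis
    by (intro RDirProd_ring cring.axioms(1) m.cring n.cring)
qed

lemma parcs_reg_graph_RDirProd_residue:
  "((a, b), (c, d)) \<in> parcs (reg_graph (RDirProd (residue_ring m) (residue_ring n))) \<longleftrightarrow>
     (a, b) \<in> pverts (reg_graph (RDirProd (residue_ring m) (residue_ring n))) \<and>
     (c, d) \<in> pverts (reg_graph (RDirProd (residue_ring m) (residue_ring n))) \<and>
     (a, b) \<noteq> (c, d) \<and>
     (a * c * a mod m = a \<and> b * d * b mod n = b \<or> c * a * c mod m = c \<and> d * b * d mod n = d)"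
  by (auto simp: reg_graph_def RDirProd_def DirProd_def monoid.defs residue_ring_def mod_mult_left_eq)

lemma reg_graph_F2_F2:
  assumes "ring R" "R \<simeq> RDirProd (residue_ring 2) (residue_ring 2)"
  shows "undirected_tree (reg_graph R) \<and> 2 \<le> card (pverts (reg_graph R))"
proof (rule reg_graph_iso_path[OF assms(1) ring_RDirProd_residue assms(2)])
  let ?S = "RDirProd (residue_ring 2) (residue_ring 2)"
  let ?k = "\<lambda>x. the (map_of [((1, 0), 0::nat), ((1, 1), 1), ((0, 1), 2)] x)"
  have "{0..2 - 1} = {0, 1 :: int}" by auto
  then have V: "pverts (reg_graph ?S) = {(1, 0), (1, 1), (0, 1)}"
    by (auto simp: reg_graph_def RDirProd_def DirProd_def monoid.defs residue_ring_def)
  have "{..<3} = {0, 1, 2::nat}" by auto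
  then show "bij_betw ?k (pverts (reg_graph ?S)) {..<3}"
    unfolding V by (simp add: bij_betw_def)
  show "(a, b) \<in> parcs (reg_graph ?S) \<longleftrightarrow> ?k a = Suc (?k b) \<or> ?k b = Suc (?k a)"
    if "a \<in> pverts (reg_graph ?S)" "b \<in> pverts (reg_graph ?S)" for a b
    using that by (cases a; cases b) (simp add: parcs_reg_graph_RDirProd_residue V, auto)
qed simp_all

lemma reg_graph_F2_F3:
  assumes "ring R" "R \<simeq> RDirProd (residue_ring 2) (residue_ring 3)"
  shows "undirected_tree (reg_graph R) \<and> 2 \<le> card (pverts (reg_graph R))"
proof (rule reg_graph_iso_path[OF assms(1) ring_RDirProd_residue assms(2)])
  let ?S = "RDirProd (residue_ring 2) (residue_ring 3)"
  \<comment> \<open>Positions along the path \<open>(0, 1)\<close>, \<open>(1, 1)\<close>,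
    \<open>(1, 0)\<close>, \<open>(1, 2)\<close>, \<open>(0, 2)\<close>: the vertex
    \<open>(1, 0)\<close> is the middle, and negating the second coordinate reflects the
    path.\<close>
  let ?k = "\<lambda>x. the (map_of [((0, 1), 0::nat), ((1, 1), 1), ((1, 0), 2), ((1, 2), 3), ((0, 2), 4)] x)"
  have "{0..2 - 1} = {0, 1 :: int}" "{0..3 - 1} = {0, 1, 2 :: int}" by auto
  then have V: "pverts (reg_graph ?S) = {(0, 1), (1, 1), (1, 0), (1, 2), (0, 2)}"
    by (auto simp: reg_graph_def RDirProd_def DirProd_def monoid.defs residue_ring_def)
  have "{..<5} = {0, 1, 2, 3, 4::nat}" by auto
  then show "bij_betw ?k (pverts (reg_graph ?S)) {..<5}"
    unfolding V by (simp add: bij_betw_def)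
  show "(a, b) \<in> parcs (reg_graph ?S) \<longleftrightarrow> ?k a = Suc (?k b) \<or> ?k b = Suc (?k a)"
    if "a \<in> pverts (reg_graph ?S)" "b \<in> pverts (reg_graph ?S)" for a b
    using that by (cases a; cases b) (simp add: parcs_reg_graph_RDirProd_residue V, auto)
qed simp_all

theorem theorem8:
  fixes R :: "('a, 'm) ring_scheme"
  assumes "cring R"
    and "finite (carrier R)"
    and "von_neumann_regular R"
  shows "undirected_tree (reg_graph R) \<and> 2 \<le> card (pverts (reg_graph R)) \<longleftrightarrow>
    R \<simeq> RDirProd (residue_ring 2) (residue_ring 2) \<or>
    R \<simeq> RDirProd (residue_ring 2) (residue_ring 3)"
proof
  interpret cring R by fact
  assume tree: "undirected_tree (reg_graph R) \<and> 2 \<le> card (pverts (reg_graph R))"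
  then obtain e f where "idempotent_splitting R e f"
    using splitting_of_connected unfolding undirected_tree_def by blast
  then interpret tree_splitting R e f
    using tree assms(3) by (simp add: tree_splitting_def tree_splitting_axioms_def)
  show "R \<simeq> RDirProd (residue_ring 2) (residue_ring 2) \<or>
    R \<simeq> RDirProd (residue_ring 2) (residue_ring 3)"
    by (rule iso_cases)
next
  assume "R \<simeq> RDirProd (residue_ring 2) (residue_ring 2) \<or>
    R \<simeq> RDirProd (residue_ring 2) (residue_ring 3)"
  then show "undirected_tree (reg_graph R) \<and> 2 \<le> card (pverts (reg_graph R))"
    using reg_graph_F2_F2 reg_graph_F2_F3 cring.axioms(1)[OF assms(1)] by blast
qed

end
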